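(* Let $L>0$, $f\in\mathcal F^1_L$, $s>0$, and let $\{x_k\},\{y_k\},\{z_k\}$ be the iterates of algorithm $(\mathcal B')$ (defined in the context). Then for each $k\ge1$ such that $\alpha_k\ge1$ and $\widetilde\alpha_k\ge0$, $$\alpha_k\widetilde\alpha_ks(f(x_k)-f^* )-\frac{\widetilde\alpha_k^2s^2}{2}\|\nabla f(x_k)\|^2+\frac12\|z_{k+1}-x^*\|^2$$ $$\le\widetilde\alpha_k(\alpha_k-1)s\Big((f(x_{k-1})-f^* )-\frac{(2-\beta_{k-1}Ls)\beta_{k-1}s}{2}\|\nabla f(x_{k-1})\|^2\Big)+\frac12\|z_k-x^*\|^2.$$
   Context: $\mathcal F^1_L$ is the set of continuously differentiable convex functions $f:\mathbb R^n\to\mathbb R$ that are $L$-smooth ($\|\nabla f(y)-\nabla f(x)\|\le L\|y-x\|$ for all $x,y$, Euclidean norm). It is assumed throughout that $f$ has a minimizer; $x^*$ denotes one of the minimizers and $f^*=f(x^* )$. Algorithm $(\mathcal B')$: given real sequences $\{\alpha_k\}_{k\ge0}$ (nonzero, so that the recursion is defined), $\{\beta_k\}_{k\ge0}$, $\{\gamma_k\}_{k\ge0}$, put $\widetilde\alpha_k=\beta_k\alpha_k+(\gamma_k-\beta_k)\alpha_{k+1}$; starting from $x_0=z_0\in\mathbb R^n$, for $k\ge0$, $$y_{k+1}=x_k-\beta_ks\nabla f(x_k),\qquad z_{k+1}=z_k-\widetilde\alpha_ks\nabla f(x_k),\qquad x_{k+1}=\frac1{\alpha_{k+1}}z_{k+1}+\Big(1-\frac1{\alpha_{k+1}}\Big)y_{k+1}.$$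 *)

theory Defs
  imports "HOL-Analysis.Analysis"
begin

definition grad :: "('a::euclidean_space \<Rightarrow> real) \<Rightarrow> 'a \<Rightarrow> 'a" where
  "grad f x = (THE D. GDERIV f x :> D)"

text \<open>Differentiability is required separately, since \<open>grad\<close> is unspecified at points
  where \<open>f\<close> is not differentiable.\<close>

definition smooth_convex :: "real \<Rightarrow> ('a::euclidean_space \<Rightarrow> real) set" where
  "smooth_convex L = {f. convex_on UNIV f
      \<and> (\<forall>x. f differentiable (at x)) \<and> continuous_on UNIV (grad f)
      \<and> (\<forall>x y. norm (grad f y - grad f x) \<le> L * norm (y - x))}"

definition alpha_tilde ::
    "(nat \<Rightarrow> real) \<Rightarrow> (nat \<Rightarrow> real) \<Rightarrow> (nat \<Rightarrow> real) \<Rightarrow> nat \<Rightarrow> real" where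
  "alpha_tilde \<alpha> \<beta> \<gamma> k = \<beta> k * \<alpha> k + (\<gamma> k - \<beta> k) * \<alpha> (k + 1)"

text \<open>The sequences \<open>x\<close>, \<open>y\<close>, \<open>z\<close> are the iterates for step size \<open>s\<close>.
  The method starts \<open>y\<close> at index 1, so \<open>y 0\<close> is left unconstrained.\<close>

definition alg_iterates ::
    "('a::euclidean_space \<Rightarrow> real) \<Rightarrow> real
      \<Rightarrow> (nat \<Rightarrow> real) \<Rightarrow> (nat \<Rightarrow> real) \<Rightarrow> (nat \<Rightarrow> real)
      \<Rightarrow> (nat \<Rightarrow> 'a) \<Rightarrow> (nat \<Rightarrow> 'a) \<Rightarrow> (nat \<Rightarrow> 'a) \<Rightarrow> bool" where
  "alg_iterates f s \<alpha> \<beta> \<gamma> x y z \<longleftrightarrow>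
      x 0 = z 0 \<and>
      (\<forall>k. y (k + 1) = x k - (\<beta> k * s) *\<^sub>R grad f (x k)
         \<and> z (k + 1) = z k - (alpha_tilde \<alpha> \<beta> \<gamma> k * s) *\<^sub>R grad f (x k)
         \<and> x (k + 1) = (1 / \<alpha> (k + 1)) *\<^sub>R z (k + 1)
                        + (1 - 1 / \<alpha> (k + 1)) *\<^sub>R y (k + 1))"

end

theory Submission
  imports Defs
begin

text \<open>By the recursion \<open>z\<^sub>k - x\<^sup>* = (x\<^sub>k - x\<^sup>*) + (\<alpha>\<^sub>k - 1) (x\<^sub>k - y\<^sub>k)\<close>. Expanding
  \<open>\<parallel>z\<^sub>k\<^sub>+\<^sub>1 - x\<^sup>*\<parallel>\<^sup>2\<close> and bounding the two resulting inner products with \<open>\<nabla>f(x\<^sub>k)\<close> by the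
  gradient inequality leaves the term \<open>f(y\<^sub>k) - f\<^sup>*\<close>, to which the descent lemma for the
  gradient step from \<open>x\<^sub>k\<^sub>-\<^sub>1\<close> to \<open>y\<^sub>k\<close> applies.\<close>

lemma GDERIV_grad:
  fixes f :: "'a::euclidean_space \<Rightarrow> real"
  assumes "f differentiable (at x)"
  shows "GDERIV f x :> grad f x"
proof -
  obtain f' where f': "(f has_derivative f') (at x)"
    using assms by (auto simp: differentiable_def)
  have "linear f'"
    using f' by (rule has_derivative_linear)
  define D where "D = adjoint f' 1"
  have "f' = (\<lambda>h. inner h D)"
    using adjoint_works[OF \<open>linear f'\<close>, of _ 1] by (auto simp: D_def fun_eq_iff)
  then have "GDERIV f x :> D"
    using f' by (simp add: gderiv_def)
  moreover have "D' = D" if "GDERIV f x :> D'" for D'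
  proof -
    have "(\<lambda>h. inner h D') = (\<lambda>h. inner h D)"
      using that \<open>GDERIV f x :> D\<close> unfolding gderiv_def
      by (rule has_derivative_unique)
    then show ?thesis
      by (metis inner_commute vector_eq_rdot)
  qed
  ultimately show ?thesis
    unfolding grad_def by (rule theI)
qed

lemma DERIV_grad_line:
  fixes f :: "'a::euclidean_space \<Rightarrow> real"
  assumes "\<And>x. f differentiable (at x)"
  shows "((\<lambda>t. f (a + t *\<^sub>R d)) has_real_derivative inner (grad f (a + t *\<^sub>R d)) d) (at t)"
proof -
  have "(f has_derivative (\<lambda>h. inner h (grad f (a + t *\<^sub>R d)))) (at (a + t *\<^sub>R d))"
    using GDERIV_grad[OF assms] by (simp add: gderiv_def)
  moreover have "((\<lambda>t. a + t *\<^sub>R d) has_derivative (\<lambda>h. h *\<^sub>R d)) (at t)"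
    by (auto intro!: derivative_eq_intros)
  ultimately have "((\<lambda>t. f (a + t *\<^sub>R d)) has_derivative
      (\<lambda>h. inner (h *\<^sub>R d) (grad f (a + t *\<^sub>R d)))) (at t)"
    by (rule has_derivative_compose[rotated])
  then show ?thesis
    by (simp add: has_field_derivative_def inner_commute mult_commute_abs)
qed

lemma convex_gradient_inequality:
  fixes f :: "'a::euclidean_space \<Rightarrow> real"
  assumes "convex_on UNIV f" and "\<And>x. f differentiable (at x)"
  shows "f a - f b \<le> inner (grad f a) (a - b)"
proof -
  have "convex_on UNIV (\<lambda>t. f (a + t *\<^sub>R (b - a)))"
  proof (rule convex_onI)
    fix t u v :: real
    assume "0 < t" "t < 1"
    have "a + ((1 - t) *\<^sub>R u + t *\<^sub>R v) *\<^sub>R (b - a)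
        = (1 - t) *\<^sub>R (a + u *\<^sub>R (b - a)) + t *\<^sub>R (a + v *\<^sub>R (b - a))"
      by (simp add: algebra_simps)
    then show "f (a + ((1 - t) *\<^sub>R u + t *\<^sub>R v) *\<^sub>R (b - a))
        \<le> (1 - t) * f (a + u *\<^sub>R (b - a)) + t * f (a + v *\<^sub>R (b - a))"
      using convex_onD[OF assms(1)] \<open>0 < t\<close> \<open>t < 1\<close> by simp
  qed simp
  from convex_on_imp_above_tangent[OF this _ _ _ DERIV_grad_line[OF assms(2)], of 0 1]
  have "f b - f a \<ge> inner (grad f a) (b - a)"
    by simp
  then show ?thesis
    by (simp add: inner_diff_right)
qed

lemma lipschitz_gradient_upper_bound:
  fixes f :: "'a::euclidean_space \<Rightarrow> real"
  assumes diff: "\<And>x. f differentiable (at x)"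
    and lip: "\<And>x y. norm (grad f y - grad f x) \<le> L * norm (y - x)"
  shows "f (a + d) \<le> f a + inner (grad f a) d + L / 2 * (norm d)\<^sup>2"
proof -
  define \<psi> where "\<psi> t = f (a + t *\<^sub>R d) - t * inner (grad f a) d - L / 2 * (norm d)\<^sup>2 * t\<^sup>2" for t
  have "\<psi> 1 \<le> \<psi> 0"
  proof (rule DERIV_nonpos_imp_nonincreasing[of 0 1])
    fix t :: real
    assume "0 \<le> t" "t \<le> 1"
    have "(\<psi> has_real_derivative
        inner (grad f (a + t *\<^sub>R d)) d - inner (grad f a) d - L * (norm d)\<^sup>2 * t) (at t)"
      unfolding \<psi>_def by (auto intro!: derivative_eq_intros DERIV_grad_line diff)
    moreover have "inner (grad f (a + t *\<^sub>R d) - grad f a) d \<le> L * (norm d)\<^sup>2 * t"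
    proof -
      have "inner (grad f (a + t *\<^sub>R d) - grad f a) d
          \<le> norm (grad f (a + t *\<^sub>R d) - grad f a) * norm d"
        by (rule norm_cauchy_schwarz)
      also have "\<dots> \<le> (L * norm (t *\<^sub>R d)) * norm d"
        using lip[of "a + t *\<^sub>R d" a] by (intro mult_right_mono) auto
      also have "\<dots> = L * (norm d)\<^sup>2 * t"
        using \<open>0 \<le> t\<close> by (simp add: power2_eq_square)
      finally show ?thesis .
    qed
    ultimately show "\<exists>y. (\<psi> has_real_derivative y) (at t) \<and> y \<le> 0"
      by (auto simp: inner_diff_left)
  qed simp
  then show ?thesis
    by (simp add: \<psi>_def)
qed

lemma gradient_step_descent:
  fixes f :: "'a::euclidean_space \<Rightarrow> real"
  assumes "\<And>x. f differentiable (at x)"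
    and "\<And>x y. norm (grad f y - grad f x) \<le> L * norm (y - x)"
  shows "f (a - h *\<^sub>R grad f a) \<le> f a - (2 - h * L) * h / 2 * (norm (grad f a))\<^sup>2"
  using lipschitz_gradient_upper_bound[OF assms, of a "- (h *\<^sub>R grad f a)"]
  unfolding power2_norm_eq_inner by (simp add: field_simps power2_eq_square)

theorem lemma4:
  fixes f :: "real ^ 'n \<Rightarrow> real"
    and x y z :: "nat \<Rightarrow> real ^ 'n"
    and xstar :: "real ^ 'n"
    and \<alpha> \<beta> \<gamma> :: "nat \<Rightarrow> real"
    and L s :: real
    and k :: nat
  assumes "L > 0"
    and "f \<in> smooth_convex L"
    and "is_arg_min f (\<lambda>_. True) xstar"
    and "s > 0"
    and "\<And>j. \<alpha> j \<noteq> 0"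
    and "alg_iterates f s \<alpha> \<beta> \<gamma> x y z"
    and "k \<ge> 1"
    and "\<alpha> k \<ge> 1"
    and "alpha_tilde \<alpha> \<beta> \<gamma> k \<ge> 0"
  shows "\<alpha> k * alpha_tilde \<alpha> \<beta> \<gamma> k * s * (f (x k) - f xstar)
           - (alpha_tilde \<alpha> \<beta> \<gamma> k)\<^sup>2 * s\<^sup>2 / 2 * (norm (grad f (x k)))\<^sup>2
           + 1 / 2 * (norm (z (k + 1) - xstar))\<^sup>2
         \<le> alpha_tilde \<alpha> \<beta> \<gamma> k * (\<alpha> k - 1) * s *
             ((f (x (k - 1)) - f xstar)
              - (2 - \<beta> (k - 1) * L * s) * \<beta> (k - 1) * s / 2 * (norm (grad f (x (k - 1))))\<^sup>2)
           + 1 / 2 * (norm (z k - xstar))\<^sup>2"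
proof -
  have conv: "convex_on UNIV f" and diff: "\<And>x. f differentiable (at x)"
    and lip: "\<And>x y. norm (grad f y - grad f x) \<le> L * norm (y - x)"
    using assms(2) by (auto simp: smooth_convex_def)
  define T where "T = alpha_tilde \<alpha> \<beta> \<gamma> k"
  define g where "g = grad f (x k)"
  define E where "E = f (x (k - 1)) - f xstar
    - (2 - \<beta> (k - 1) * L * s) * \<beta> (k - 1) * s / 2 * (norm (grad f (x (k - 1))))\<^sup>2"
  have "k - 1 + 1 = k"
    using \<open>k \<ge> 1\<close> by simp
  with assms(6) have y: "y k = x (k - 1) - (\<beta> (k - 1) * s) *\<^sub>R grad f (x (k - 1))"
    and x: "x k = (1 / \<alpha> k) *\<^sub>R z k + (1 - 1 / \<alpha> k) *\<^sub>R y k"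
    unfolding alg_iterates_def by metis+
  have z: "z (k + 1) - xstar = (z k - xstar) - (T * s) *\<^sub>R g"
    using assms(6) by (simp add: alg_iterates_def T_def g_def)
  have "\<alpha> k *\<^sub>R x k = z k + (\<alpha> k - 1) *\<^sub>R y k"
    using assms(5)[of k] by (simp add: x scaleR_add_right right_diff_distrib)
  then have zk: "z k - xstar = (x k - xstar) + (\<alpha> k - 1) *\<^sub>R (x k - y k)"
    by (simp add: algebra_simps)
  have "f (y k) - f xstar \<le> E"
    using gradient_step_descent[OF diff lip, of "x (k - 1)" "\<beta> (k - 1) * s"]
    by (simp add: y E_def mult_ac)
  moreover have "f (x k) - f (y k) \<le> inner g (x k - y k)"
    unfolding g_def by (rule convex_gradient_inequality[OF conv diff])
  ultimately have "f (x k) - f xstar - E \<le> inner g (x k - y k)"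
    by linarith
  then have "(\<alpha> k - 1) * (f (x k) - f xstar - E) \<le> (\<alpha> k - 1) * inner g (x k - y k)"
    using \<open>\<alpha> k \<ge> 1\<close> by (intro mult_left_mono) auto
  moreover have "f (x k) - f xstar \<le> inner g (x k - xstar)"
    unfolding g_def by (rule convex_gradient_inequality[OF conv diff])
  ultimately have "\<alpha> k * (f (x k) - f xstar) - (\<alpha> k - 1) * E \<le> inner g (z k - xstar)"
    by (simp add: zk inner_add_right algebra_simps)
  then have "(T * s) * (\<alpha> k * (f (x k) - f xstar) - (\<alpha> k - 1) * E) \<le> (T * s) * inner g (z k - xstar)"
    using assms(4,9) by (intro mult_left_mono) (auto simp: T_def)
  moreover have "(norm (z (k + 1) - xstar))\<^sup>2
      = (norm (z k - xstar))\<^sup>2 - 2 * ((T * s) * inner g (z k - xstar)) + T\<^sup>2 * s\<^sup>2 * (norm g)\<^sup>2"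
    unfolding z power2_norm_eq_inner
    by (simp add: inner_diff_left inner_diff_right inner_commute power2_eq_square algebra_simps)
  ultimately have "\<alpha> k * T * s * (f (x k) - f xstar) - T\<^sup>2 * s\<^sup>2 / 2 * (norm g)\<^sup>2
      + 1 / 2 * (norm (z (k + 1) - xstar))\<^sup>2
      \<le> T * (\<alpha> k - 1) * s * E + 1 / 2 * (norm (z k - xstar))\<^sup>2"
    by (simp add: algebra_simps)
  then show ?thesis
    by (simp only: T_def g_def E_def)
qed

end
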